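(* Let $n\ge 1$ and $c\neq 0$. Let $a_1,\ldots,a_n,b_1,\ldots,b_n$ be nonzero parameters (generic, so that all denominators below are nonzero), and put $$A=\{a_1,c/a_1,\ldots,a_n,c/a_n\},\qquad B=\{b_1,c/b_1,\ldots,b_n,c/b_n\}.$$ Let $f(y)$ be a polynomial of degree $2n$ satisfying the symmetry $y^{-n}f(y)=(c/y)^{-n}f(c/y)$. Then \begin{align*} f(y)&=\frac{f(b_1)}{\prod_{i=1}^n(b_1-a_i)(b_1-c/a_i)}\prod_{i=1}^n(y-a_i)(y-c/a_i) +\frac{f(a_1)}{\prod_{i=1}^n(a_1-b_i)(a_1-c/b_i)}\prod_{i=1}^n(y-b_i)(y-c/b_i)\\ &\quad+\sum_{j=1}^{n-1}C_j\prod_{i=1}^j(y-b_i)(y-c/b_i)\prod_{i=1}^{n-j}(y-a_i)(y-c/a_i), \end{align*} where $$C_j=\frac{f(b_1)\,b_1^{1-j}}{\prod_{i=1}^{n-j+1}(b_1-a_i)(b_1-c/a_i)}\,\partial^{c}_1\cdots\partial^{c}_j\;\cdot\;(b_{j+1}-a_{n-j+1})\bigl(1-c/(a_{n-j+1}b_{j+1})\bigr),$$ in which the operators $\partial^c_1,\ldots,\partial^c_j$ act on the variables $b_1,\ldots,b_{j+1}$ (i.e. $\partial^c_i$ interchanges $b_i$ and $b_{i+1}$), and are applied to the function $f(b_1)b_1^{1-j}/\prod_{i=1}^{n-j+1}(b_1-a_i)(b_1-c/a_i)$ before multiplying by the last factor.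
   Context: For a parameter $c$, the $i$-th $c$-divided difference operator $\partial^c_i$ acts (written on the right) on functions of variables $x_1,x_2,\ldots$ by $$f(x_1,\ldots,x_i,x_{i+1},\ldots)\,\partial^c_i=\frac{f(x_1,\ldots,x_i,x_{i+1},\ldots)-f(x_1,\ldots,x_{i+1},x_i,\ldots)}{(x_i-x_{i+1})(1-c/(x_ix_{i+1}))}.$$ A product $f\,\partial^c_1\cdots\partial^c_j$ means: apply $\partial^c_1$ first, then $\partial^c_2$, and so on. *)

theory Defs
  imports "HOL-Computational_Algebra.Polynomial" "HOL-Combinatorics.Transposition"
begin

text \<open>A function of the variables \<open>x\<^sub>1, x\<^sub>2, \<dots>\<close> is a map on assignments \<open>x :: nat \<Rightarrow> 'a\<close>,
  the value \<open>x 0\<close> being ignored.\<close>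

definition cdivdiff ::
    "'a::field \<Rightarrow> nat \<Rightarrow> ((nat \<Rightarrow> 'a) \<Rightarrow> 'a) \<Rightarrow> (nat \<Rightarrow> 'a) \<Rightarrow> 'a" where
  "cdivdiff c i g = (\<lambda>x. (g x - g (x \<circ> transpose i (Suc i))) /
     ((x i - x (Suc i)) * (1 - c / (x i * x (Suc i)))))"

text \<open>The operators act from the right, so the one with index \<open>1\<close> is applied first; this is
  the order in which \<open>fold\<close> runs through the list.\<close>

definition cdivdiffs ::
    "'a::field \<Rightarrow> nat \<Rightarrow> ((nat \<Rightarrow> 'a) \<Rightarrow> 'a) \<Rightarrow> (nat \<Rightarrow> 'a) \<Rightarrow> 'a" where
  "cdivdiffs c j g = fold (cdivdiff c) [1..<Suc j] g"

definition interp_coeff ::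
    "'a::field \<Rightarrow> nat \<Rightarrow> 'a poly \<Rightarrow> (nat \<Rightarrow> 'a) \<Rightarrow> (nat \<Rightarrow> 'a) \<Rightarrow> nat \<Rightarrow> 'a" where
  "interp_coeff c n f a b j =
     cdivdiffs c j
       (\<lambda>x. poly f (x 1) * x 1 powi (1 - int j) /
             (\<Prod>i = 1..n - j + 1. (x 1 - a i) * (x 1 - c / a i))) b
     * ((b (j + 1) - a (n - j + 1)) * (1 - c / (a (n - j + 1) * b (j + 1))))"

end

theory Submission
  imports Defs
begin

text \<open>
  Since \<open>(y - a) (y - c/a) = y (u - \<alpha>)\<close> and \<open>(x - y) (1 - c/(x y)) = (x + c/x) - (y + c/y)\<close> for
  \<open>u = y + c/y\<close> and \<open>\<alpha> = a + c/a\<close>, and since \<open>f(y) = y\<^sup>n F(u)\<close> for a polynomial \<open>F\<close> of degree at most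
  \<open>n\<close>, the theorem is about ordinary divided differences in the variables \<open>\<beta>\<^sub>i = b\<^sub>i + c/b\<^sub>i\<close>. With
  \<open>P\<^sub>m = \<Prod>\<^sub>i\<^sub>\<le>\<^sub>m (u - \<alpha>\<^sub>i)\<close>, \<open>N\<^sub>j = \<Prod>\<^sub>i\<^sub>\<le>\<^sub>j (u - \<beta>\<^sub>i)\<close> and \<open>G\<^sub>m = F / P\<^sub>m\<close>, the remainders
  \<open>T\<^sub>j = P\<^bsub>n-j+1\<^esub> N\<^sub>j \<cdot> [\<beta>\<^sub>1, \<dots>, \<beta>\<^sub>j, u] G\<^bsub>n-j+1\<^esub>\<close> satisfy \<open>T\<^sub>j - T\<^bsub>j+1\<^esub> = C\<^sub>j N\<^sub>j P\<^bsub>n-j\<^esub>\<close> by the Leibniz rule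
  for the product \<open>G\<^bsub>n-j\<^esub> = (u - \<alpha>\<^bsub>n-j+1\<^esub>) G\<^bsub>n-j+1\<^esub>\<close>. The sum telescopes from \<open>T\<^sub>1\<close>, which is \<open>F\<close> minus
  the first term, to \<open>T\<^sub>n\<close>, which is the second term.
\<close>

section \<open>Ordinary divided differences\<close>

text \<open>\<open>divdiff \<beta> h j t\<close> is the divided difference of \<open>h\<close> at the nodes \<open>\<beta> 1, \<dots>, \<beta> j, t\<close>.\<close>

fun divdiff :: "(nat \<Rightarrow> 'a::field) \<Rightarrow> ('a \<Rightarrow> 'a) \<Rightarrow> nat \<Rightarrow> 'a \<Rightarrow> 'a" where
  "divdiff \<beta> h 0 t = h t"
| "divdiff \<beta> h (Suc j) t = (divdiff \<beta> h j t - divdiff \<beta> h j (\<beta> (Suc j))) / (t - \<beta> (Suc j))"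

lemma divdiff_cong:
  assumes "\<And>i. i \<in> {1..j} \<Longrightarrow> \<beta> i = \<beta>' i" and "h t = h' t"
    and "\<And>i. i \<in> {1..j} \<Longrightarrow> h (\<beta> i) = h' (\<beta> i)"
  shows "divdiff \<beta> h j t = divdiff \<beta>' h' j t"
  using assms
proof (induction j arbitrary: t)
  case (Suc j)
  have "divdiff \<beta> h j t = divdiff \<beta>' h' j t"
    using Suc.prems by (intro Suc.IH) auto
  moreover have "divdiff \<beta> h j (\<beta> (Suc j)) = divdiff \<beta>' h' j (\<beta> (Suc j))"
    using Suc.prems by (intro Suc.IH) auto
  ultimately show ?case
    using Suc.prems(1)[of "Suc j"] by simp
qed simp

lemma divdiff_linear:
  "divdiff \<beta> (\<lambda>s. k * g s + h s) j t = k * divdiff \<beta> g j t + divdiff \<beta> h j t"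
  by (induction j arbitrary: t) (simp_all add: algebra_simps diff_divide_distrib add_divide_distrib)

text \<open>The factor \<open>s - \<alpha>\<close> has divided differences
  \<open>t - \<alpha>\<close>, \<open>1\<close>, \<open>0\<close>, \<open>0\<close>, ... of orders
  0, 1, 2, 3, ..., so only two terms of the general Leibniz rule survive. In the induction the rule
  is used at \<open>t\<close> and at the new node; the lower-order terms agree and cancel.\<close>

lemma divdiff_Leibniz:
  assumes "inj_on \<beta> {1..Suc j}" and "t \<notin> \<beta> ` {1..Suc j}"
  shows "divdiff \<beta> (\<lambda>s. (s - \<alpha>) * h s) (Suc j) t
    = (t - \<alpha>) * divdiff \<beta> h (Suc j) t + divdiff \<beta> h j (\<beta> (Suc j))"
  using assms
proof (induction j arbitrary: t)
  case 0
  then have "t - \<beta> 1 \<noteq> 0" by auto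
  then show ?case by (simp add: field_simps)
next
  case (Suc j)
  let ?s = "\<beta> (Suc (Suc j))"
  have ts: "t - ?s \<noteq> 0" using Suc.prems by auto
  have inj: "inj_on \<beta> {1..Suc j}"
    using Suc.prems(1) by (rule inj_on_subset) auto
  have "t \<notin> \<beta> ` {1..Suc j}" using Suc.prems(2) by auto
  note t = Suc.IH[OF inj this]
  have "?s \<notin> \<beta> ` {1..Suc j}"
    using Suc.prems(1) by (force simp: inj_on_def)
  note s = Suc.IH[OF inj this]
  define A where "A = divdiff \<beta> h (Suc j) t"
  define B where "B = divdiff \<beta> h (Suc j) ?s"
  have "((t - \<alpha>) * A - (?s - \<alpha>) * B) / (t - ?s) = (t - \<alpha>) * ((A - B) / (t - ?s)) + B"
    using ts by (simp add: field_simps)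
  moreover have "divdiff \<beta> (\<lambda>s. (s - \<alpha>) * h s) (Suc (Suc j)) t
      = ((t - \<alpha>) * A - (?s - \<alpha>) * B) / (t - ?s)"
    unfolding divdiff.simps(2)[of _ _ "Suc j"] t s A_def B_def by simp
  moreover have "divdiff \<beta> h (Suc (Suc j)) t = (A - B) / (t - ?s)"
    unfolding divdiff.simps(2)[of _ _ "Suc j"] A_def B_def ..
  ultimately show ?case by (simp only: B_def)
qed

text \<open>The difference quotient of \<open>1 / (t - \<alpha>)\<close> between \<open>t\<close>
  and a node \<open>s\<close> is \<open>1 / ((t - \<alpha>) * (\<alpha> - s))\<close>, so every
  order keeps the shape and gains one constant factor; writing it \<open>\<alpha> - s\<close>
  absorbs the sign.\<close>

lemma divdiff_inverse_linear:
  assumes "inj_on \<beta> {1..j}" and "t \<notin> \<beta> ` {1..j}" and "\<alpha> \<notin> \<beta> ` {1..j}" and "t \<noteq> \<alpha>"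
  shows "divdiff \<beta> (\<lambda>s. 1 / (s - \<alpha>)) j t = 1 / ((t - \<alpha>) * (\<Prod>i = 1..j. \<alpha> - \<beta> i))"
  using assms
proof (induction j arbitrary: t)
  case (Suc j)
  let ?s = "\<beta> (Suc j)"
  define K where "K = (\<Prod>i = 1..j. \<alpha> - \<beta> i)"
  have K: "K \<noteq> 0" using Suc.prems(3) by (auto simp: K_def)
  have inj: "inj_on \<beta> {1..j}"
    using Suc.prems(1) by (rule inj_on_subset) auto
  have ne: "t \<noteq> ?s" "\<alpha> \<noteq> ?s" "t \<noteq> \<alpha>" using Suc.prems by auto
  have t: "divdiff \<beta> (\<lambda>s. 1 / (s - \<alpha>)) j t = 1 / ((t - \<alpha>) * K)"
    unfolding K_def using Suc.prems inj by (intro Suc.IH) auto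
  have "?s \<notin> \<beta> ` {1..j}"
    using Suc.prems(1) by (force simp: inj_on_def)
  then have s: "divdiff \<beta> (\<lambda>s. 1 / (s - \<alpha>)) j ?s = 1 / ((?s - \<alpha>) * K)"
    unfolding K_def using Suc.prems inj by (intro Suc.IH) auto
  have "(1 / ((t - \<alpha>) * K) - 1 / ((?s - \<alpha>) * K)) / (t - ?s) = 1 / ((t - \<alpha>) * (K * (\<alpha> - ?s)))"
    using ne K by (simp add: divide_simps) (simp add: algebra_simps)
  then show ?case
    by (simp add: t s K_def)
qed simp

lemma poly_eq_linear_factor_plus_const:
  fixes p :: "'a::comm_ring_1 poly"
  shows "poly p t = poly p \<alpha> + (t - \<alpha>) * poly (synthetic_div p \<alpha>) t"
  using arg_cong[OF synthetic_div_correct[of p \<alpha>], of "\<lambda>q. poly q t"]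
  by (simp add: algebra_simps)

text \<open>The difference quotient of a polynomial between \<open>t\<close> and \<open>s\<close> is
  its synthetic quotient at \<open>s\<close>, so each order lowers the degree by one until 0 is
  reached. The disjunct \<open>q = 0\<close> is separate because \<open>degree 0 = 0\<close> breaks
  the strict bound once \<open>j \<ge> m\<close>. At a node the recursion would divide by
  zero.\<close>

lemma divdiff_poly_eq_poly:
  assumes "inj_on \<beta> {1..j}" and "degree p < m"
  shows "\<exists>q. (q = 0 \<or> degree q + j < m) \<and>
    (\<forall>t. t \<notin> \<beta> ` {1..j} \<longrightarrow> divdiff \<beta> (poly p) j t = poly q t)"
  using assms
proof (induction j)
  case 0
  then show ?case by auto
next
  case (Suc j)
  let ?s = "\<beta> (Suc j)"
  have "inj_on \<beta> {1..j}"
    using Suc.prems(1) by (rule inj_on_subset) auto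
  then obtain q where q: "q = 0 \<or> degree q + j < m"
    "\<And>t. t \<notin> \<beta> ` {1..j} \<Longrightarrow> divdiff \<beta> (poly p) j t = poly q t"
    using Suc.IH Suc.prems by blast
  have s: "?s \<notin> \<beta> ` {1..j}"
    using Suc.prems(1) by (force simp: inj_on_def)
  define r where "r = synthetic_div q ?s"
  have "r = 0 \<or> degree r + Suc j < m"
    using q(1) by (cases "degree q = 0")
      (auto simp: r_def degree_synthetic_div synthetic_div_eq_0_iff)
  moreover have "divdiff \<beta> (poly p) (Suc j) t = poly r t" if "t \<notin> \<beta> ` {1..Suc j}" for t
  proof -
    have "t \<notin> \<beta> ` {1..j}" "t \<noteq> ?s" using that by auto
    then show ?thesis
      using q(2)[OF s] q(2)[of t] poly_eq_linear_factor_plus_const[of q t ?s]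
      by (simp add: r_def)
  qed
  ultimately show ?case by blast
qed

lemma divdiff_poly_eq_0:
  assumes "inj_on \<beta> {1..j}" and "t \<notin> \<beta> ` {1..j}" and "degree p < j"
  shows "divdiff \<beta> (poly p) j t = 0"
  using divdiff_poly_eq_poly[OF assms(1,3)] assms(2) by auto

text \<open>Synthetic division splits the function into
  \<open>poly F \<alpha> / (s - \<alpha>)\<close> and a polynomial of degree below \<open>n\<close>,
  which the divided difference of order \<open>n\<close> annihilates. This evaluates the last
  remainder of the telescoping.\<close>

lemma divdiff_poly_over_linear:
  assumes inj: "inj_on \<beta> {1..n}" and t: "t \<notin> \<beta> ` {1..n}" and \<alpha>: "\<alpha> \<notin> \<beta> ` {1..n}" "t \<noteq> \<alpha>"
    and "n \<ge> 1" and "degree F \<le> n"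
  shows "divdiff \<beta> (\<lambda>s. poly F s / (s - \<alpha>)) n t
    = poly F \<alpha> / ((t - \<alpha>) * (\<Prod>i = 1..n. \<alpha> - \<beta> i))"
proof -
  define Q where "Q = synthetic_div F \<alpha>"
  have "poly F s / (s - \<alpha>) = poly F \<alpha> * (1 / (s - \<alpha>)) + poly Q s" if "s \<noteq> \<alpha>" for s
    using that poly_eq_linear_factor_plus_const[of F s \<alpha>] by (simp add: Q_def field_simps)
  moreover have "\<beta> i \<noteq> \<alpha>" if "i \<in> {1..n}" for i
    using \<alpha>(1) that by blast
  ultimately have "divdiff \<beta> (\<lambda>s. poly F s / (s - \<alpha>)) n t
      = divdiff \<beta> (\<lambda>s. poly F \<alpha> * (1 / (s - \<alpha>)) + poly Q s) n t"
    using \<alpha>(2) by (intro divdiff_cong) blast+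
  moreover have "degree Q < n"
    using \<open>n \<ge> 1\<close> \<open>degree F \<le> n\<close> by (simp add: Q_def degree_synthetic_div)
  ultimately show ?thesis
    using divdiff_linear[of \<beta> "poly F \<alpha>" "\<lambda>s. 1 / (s - \<alpha>)" "poly Q" n t]
      divdiff_inverse_linear[OF inj t \<alpha>] divdiff_poly_eq_0[OF inj t] by simp
qed

section \<open>Two-sided Newton interpolation in the variable \<open>t\<close>\<close>

text \<open>The bound \<open>k + i \<le> n + 2\<close> describes the pairs that meet in a
  denominator: the \<open>j\<close>-th coefficient has nodes up to index \<open>j + 1\<close> and
  poles up to index \<open>n - j + 1\<close>.\<close>

lemma two_sided_Newton_interpolation:
  fixes \<alpha> \<beta> :: "nat \<Rightarrow> 'a::field"
  assumes n: "n \<ge> 1" and deg: "degree F \<le> n"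
    and inj: "inj_on \<beta> {1..n}" and t\<beta>: "t \<notin> \<beta> ` {1..n}" and t\<alpha>: "t \<notin> \<alpha> ` {1..n}"
    and \<beta>\<alpha>: "\<And>k i. k \<in> {1..n} \<Longrightarrow> i \<in> {1..n} \<Longrightarrow> k + i \<le> n + 2 \<Longrightarrow> \<beta> k \<noteq> \<alpha> i"
  shows "poly F t =
      poly F (\<beta> 1) / (\<Prod>i = 1..n. \<beta> 1 - \<alpha> i) * (\<Prod>i = 1..n. t - \<alpha> i)
    + poly F (\<alpha> 1) / (\<Prod>i = 1..n. \<alpha> 1 - \<beta> i) * (\<Prod>i = 1..n. t - \<beta> i)
    + (\<Sum>j = 1..n - 1.
        divdiff \<beta> (\<lambda>s. poly F s / (\<Prod>i = 1..n - j + 1. s - \<alpha> i)) j (\<beta> (j + 1))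
        * (\<beta> (j + 1) - \<alpha> (n - j + 1))
        * (\<Prod>i = 1..j. t - \<beta> i) * (\<Prod>i = 1..n - j. t - \<alpha> i))"
proof -
  define G where "G m s = poly F s / (\<Prod>i = 1..m. s - \<alpha> i)" for m s
  define P where "P m = (\<Prod>i = 1..m. t - \<alpha> i)" for m
  define N where "N m = (\<Prod>i = 1..m. t - \<beta> i)" for m
  define D where "D j = divdiff \<beta> (G (n - j + 1)) j (\<beta> (j + 1))
    * (\<beta> (j + 1) - \<alpha> (n - j + 1)) * N j * P (n - j)" for j
  have telescope: "poly F t = G n (\<beta> 1) * P n + (\<Sum>k = 1..j - 1. D k)
      + P (n - j + 1) * N j * divdiff \<beta> (G (n - j + 1)) j t" if "1 \<le> j" "j \<le> n" for j
    using that
  proof (induction j rule: nat_induct_at_least)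
    case base
    have "t - \<beta> 1 \<noteq> 0" "P n \<noteq> 0" using t\<beta> t\<alpha> n by (auto simp: P_def)
    moreover have "G n t * P n = poly F t"
      using \<open>P n \<noteq> 0\<close> by (simp add: G_def P_def)
    ultimately show ?case
      using n by (simp add: N_def field_simps)
  next
    case (Suc j)
    define m where "m = n - j"
    have m: "n - j + 1 = Suc m" "n - Suc j + 1 = m" "m \<ge> 1" "Suc m \<le> n" "j + m = n"
      using Suc by (auto simp: m_def)
    \<comment> \<open>Division by zero gives 0, so at \<open>s = \<alpha> (Suc m)\<close> the right
      side is 0 whereas \<open>G m s\<close> need not be. The nodes up to
      \<open>\<beta> (Suc j)\<close> avoid this pole because
      \<open>Suc j + Suc m = n + 2\<close>.\<close>
    have G: "G m s = (s - \<alpha> (Suc m)) * G (Suc m) s" if "s \<noteq> \<alpha> (Suc m)" for s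
      using that by (simp add: G_def)
    have "divdiff \<beta> (G m) (Suc j) t
        = divdiff \<beta> (\<lambda>s. (s - \<alpha> (Suc m)) * G (Suc m) s) (Suc j) t"
      using Suc.prems m t\<alpha> \<beta>\<alpha> by (intro divdiff_cong G) auto
    also have "\<dots> = (t - \<alpha> (Suc m)) * divdiff \<beta> (G (Suc m)) (Suc j) t
        + divdiff \<beta> (G (Suc m)) j (\<beta> (Suc j))"
      using Suc.prems t\<beta> by (intro divdiff_Leibniz inj_on_subset[OF inj]) auto
    finally have L: "divdiff \<beta> (G m) (Suc j) t = \<dots>" .
    \<comment> \<open>Clearing the denominator, the value at \<open>\<beta> (Suc j)\<close> gets the
      coefficient \<open>(t - \<beta> (Suc j)) - (t - \<alpha> (Suc m))\<close>. This is the source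
      of the last factor of the interpolation coefficient.\<close>
    have "t - \<beta> (Suc j) \<noteq> 0" using t\<beta> Suc.prems by auto
    then have "(t - \<beta> (Suc j)) * divdiff \<beta> (G m) (Suc j) t
        = (t - \<alpha> (Suc m)) * divdiff \<beta> (G (Suc m)) j t
          - (\<beta> (Suc j) - \<alpha> (Suc m)) * divdiff \<beta> (G (Suc m)) j (\<beta> (Suc j))"
      unfolding L unfolding divdiff.simps(2)[of _ _ j] by (simp add: field_simps)
    then have "P m * N j * ((t - \<beta> (Suc j)) * divdiff \<beta> (G m) (Suc j) t)
        = P m * N j * ((t - \<alpha> (Suc m)) * divdiff \<beta> (G (Suc m)) j t
          - (\<beta> (Suc j) - \<alpha> (Suc m)) * divdiff \<beta> (G (Suc m)) j (\<beta> (Suc j)))"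
      by simp
    moreover have "P (Suc m) = P m * (t - \<alpha> (Suc m))" "N (Suc j) = N j * (t - \<beta> (Suc j))"
      by (simp_all add: P_def N_def)
    moreover have "D j = divdiff \<beta> (G (Suc m)) j (\<beta> (Suc j)) * (\<beta> (Suc j) - \<alpha> (Suc m)) * N j * P m"
      by (simp add: D_def m_def)
    ultimately have "P (Suc m) * N j * divdiff \<beta> (G (Suc m)) j t
        = D j + P m * N (Suc j) * divdiff \<beta> (G m) (Suc j) t"
      by algebra
    moreover have "(\<Sum>k = 1..Suc j - 1. D k) = (\<Sum>k = 1..j - 1. D k) + D j"
      using Suc.hyps by (cases j) auto
    moreover have "poly F t = G n (\<beta> 1) * P n + (\<Sum>k = 1..j - 1. D k)
      + P (Suc m) * N j * divdiff \<beta> (G (Suc m)) j t"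
      using Suc.IH Suc.prems m by simp
    ultimately show ?case
      unfolding m by simp
  qed
  \<comment> \<open>For \<open>j = n\<close> the prefactor \<open>P 1\<close> is
    \<open>t - \<alpha> 1\<close>; it cancels the same factor in the closed form, which leaves the
    second interpolation term.\<close>
  have "\<alpha> 1 \<notin> \<beta> ` {1..n}" "t \<noteq> \<alpha> 1"
    using \<beta>\<alpha>[of _ 1] t\<alpha> n by force+
  then have "P 1 * N n * divdiff \<beta> (G 1) n t = poly F (\<alpha> 1) / (\<Prod>i = 1..n. \<alpha> 1 - \<beta> i) * N n"
    using divdiff_poly_over_linear[OF inj t\<beta> _ _ n deg, of "\<alpha> 1"] by (simp add: G_def[abs_def] P_def)
  then show ?thesis
    using telescope[OF n order.refl] by (simp add: G_def[abs_def] P_def N_def D_def)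
qed

section \<open>The change of variable \<open>x + c / x\<close>\<close>

lemma c_difference:
  fixes c x y :: "'a::field"
  assumes "x \<noteq> 0" and "y \<noteq> 0"
  shows "(x - y) * (1 - c / (x * y)) = (x + c / x) - (y + c / y)"
  using assms by (simp add: field_simps)

lemma c_quadratic:
  fixes c x y :: "'a::field"
  assumes "x \<noteq> 0" and "y \<noteq> 0"
  shows "(x - y) * (x - c / y) = x * ((x + c / x) - (y + c / y))"
  using assms by (simp add: field_simps)

text \<open>After \<open>j\<close> operators the result is a divided difference with nodes from
  \<open>x 1, ..., x j\<close> and evaluation point from \<open>x (Suc j)\<close>. The next
  transposition only moves the evaluation point to \<open>x (Suc (Suc j))\<close>, so the operator
  forms the next difference quotient.\<close>

lemma cdivdiffs_eq_divdiff:
  assumes "\<And>i. i \<in> {1..Suc j} \<Longrightarrow> x i \<noteq> 0"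
    and "\<And>i. i \<in> {1..Suc j} \<Longrightarrow> g (x i) = h (x i + c / x i)"
  shows "cdivdiffs c j (\<lambda>x. g (x 1)) x
    = divdiff (\<lambda>i. x i + c / x i) h j (x (Suc j) + c / x (Suc j))"
  using assms
proof (induction j arbitrary: x)
  case 0
  then show ?case by (simp add: cdivdiffs_def)
next
  case (Suc j)
  define x' where "x' = x \<circ> transpose (Suc j) (Suc (Suc j))"
  let ?u = "\<lambda>x i. x i + c / x i"
  have x': "x' i = x i" if "i \<in> {1..j}" for i
    using that by (simp add: x'_def transpose_def)
  have x'_last: "x' (Suc j) = x (Suc (Suc j))"
    by (simp add: x'_def)
  have 1: "cdivdiffs c j (\<lambda>x. g (x 1)) x = divdiff (?u x) h j (?u x (Suc j))"
    using Suc.prems by (intro Suc.IH) auto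
  have *: "x' i \<noteq> 0 \<and> g (x' i) = h (x' i + c / x' i)" if "i \<in> {1..Suc j}" for i
    using that Suc.prems[of i] Suc.prems[of "Suc (Suc j)"] x'[of i] x'_last
    by (cases "i = Suc j") auto
  then have "cdivdiffs c j (\<lambda>x. g (x 1)) x' = divdiff (?u x') h j (?u x' (Suc j))"
    by (intro Suc.IH) auto
  also have "\<dots> = divdiff (?u x) h j (?u x (Suc (Suc j)))"
    unfolding x'_last using x' by (intro divdiff_cong) auto
  finally have 2: "cdivdiffs c j (\<lambda>x. g (x 1)) x' = \<dots>" .
  have "cdivdiffs c (Suc j) (\<lambda>x. g (x 1)) x
      = (cdivdiffs c j (\<lambda>x. g (x 1)) x - cdivdiffs c j (\<lambda>x. g (x 1)) x') /
        ((x (Suc j) - x (Suc (Suc j))) * (1 - c / (x (Suc j) * x (Suc (Suc j)))))"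
    by (simp add: cdivdiffs_def cdivdiff_def x'_def)
  also have "\<dots> = (divdiff (?u x) h j (?u x (Suc j)) - divdiff (?u x) h j (?u x (Suc (Suc j)))) /
      (?u x (Suc j) - ?u x (Suc (Suc j)))"
    unfolding 1 2 using Suc.prems by (subst c_difference) auto
  \<comment> \<open>The operator subtracts the new point from the old one, \<open>divdiff\<close>
    the old from the new: both signs flip.\<close>
  also have "\<dots> = divdiff (?u x) h (Suc j) (?u x (Suc (Suc j)))"
    using minus_divide_divide[of "divdiff (?u x) h j (?u x (Suc j)) - divdiff (?u x) h j (?u x (Suc (Suc j)))"
      "?u x (Suc j) - ?u x (Suc (Suc j))"] by (simp only: divdiff.simps minus_diff_eq)
  finally show ?case .
qed

section \<open>Self-reciprocal polynomials as polynomials in \<open>z + c / z\<close>\<close>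

lemma poly_eq_if_cofinitely_eq:
  fixes p q :: "'a::field_char_0 poly"
  assumes "finite S" and "\<And>z. z \<notin> S \<Longrightarrow> poly p z = poly q z"
  shows "p = q"
proof (rule ccontr)
  assume "p \<noteq> q"
  then have "finite {z. poly (p - q) z = 0}" by (intro poly_roots_finite) simp
  moreover have "UNIV \<subseteq> S \<union> {z. poly (p - q) z = 0}" using assms(2) by auto
  ultimately have "finite (UNIV :: 'a set)" using assms(1) finite_subset by blast
  then show False using infinite_UNIV_char_0 by blast
qed

text \<open>The symmetry reverses coefficients: \<open>z ^ (2 * n) * poly f (c / z)\<close> is a
  polynomial \<open>R\<close> whose exponents \<open>2 * n - i\<close> are all positive when
  \<open>degree f < 2 * n\<close>, so its constant term vanishes.\<close>

lemma self_reciprocal_coeff_0: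
  fixes c :: "'a::field_char_0" and f :: "'a poly"
  assumes c: "c \<noteq> 0" and deg: "degree f < 2 * n"
    and sym: "\<And>z. z \<noteq> 0 \<Longrightarrow> c ^ n * poly f z = z ^ (2 * n) * poly f (c / z)"
  shows "coeff f 0 = 0"
proof -
  define R where "R = (\<Sum>i\<le>degree f. monom (coeff f i * c ^ i) (2 * n - i))"
  have "poly (smult (c ^ n) f) z = poly R z" if "z \<notin> {0}" for z
  proof -
    have "poly R z = (\<Sum>i\<le>degree f. coeff f i * c ^ i * z ^ (2 * n - i))"
      by (simp add: R_def poly_sum poly_monom)
    also have "\<dots> = (\<Sum>i\<le>degree f. z ^ (2 * n) * (coeff f i * (c / z) ^ i))"
    proof (rule sum.cong)
      fix i assume "i \<in> {..degree f}"
      then have "z ^ (2 * n) = z ^ (2 * n - i) * z ^ i"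
        using deg by (simp flip: power_add)
      then show "coeff f i * c ^ i * z ^ (2 * n - i) = z ^ (2 * n) * (coeff f i * (c / z) ^ i)"
        using that by (simp add: power_divide)
    qed simp
    also have "\<dots> = z ^ (2 * n) * poly f (c / z)"
      by (simp add: poly_altdef sum_distrib_left)
    finally show ?thesis using sym that by simp
  qed
  then have "smult (c ^ n) f = R"
    by (intro poly_eq_if_cofinitely_eq[of "{0}"]) auto
  then have "c ^ n * coeff f 0 = coeff R 0" by (metis coeff_smult)
  also have "\<dots> = 0" using deg by (simp add: R_def coeff_sum)
  finally show ?thesis using c by simp
qed

text \<open>Subtracting a multiple of \<open>(z^2 + c) ^ n\<close>, which is
  \<open>z ^ n * (z + c / z) ^ n\<close>, removes the coefficient of index \<open>2 * n\<close>. By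
  symmetry the constant term then vanishes too, and dividing by \<open>z\<close> leaves a symmetric
  polynomial for \<open>n - 1\<close>.\<close>

lemma self_reciprocal_poly_obtain:
  fixes c :: "'a::field_char_0" and f :: "'a poly"
  assumes c: "c \<noteq> 0" and deg: "degree f \<le> 2 * n"
    and sym: "\<And>z. z \<noteq> 0 \<Longrightarrow> c ^ n * poly f z = z ^ (2 * n) * poly f (c / z)"
  obtains F where "degree F \<le> n" and "\<And>z. z \<noteq> 0 \<Longrightarrow> poly f z = z ^ n * poly F (z + c / z)"
  using deg sym
proof (induction n arbitrary: f thesis)
  case 0
  then obtain k where "f = [:k:]" by (auto elim: degree_eq_zeroE)
  then show ?case using 0(1)[of "[:k:]"] by simp
next
  case (Suc n)
  \<comment> \<open>This is not \<open>lead_coeff f\<close>: the induction allows a smaller degree,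
    and then \<open>k\<close> is 0.\<close>
  define k where "k = coeff f (2 * Suc n)"
  define q where "q = [:c, 0, 1:]"
  define g where "g = f - smult k (q ^ Suc n)"
  have qz: "poly q z = z * (z + c / z)" if "z \<noteq> 0" for z
    using that by (simp add: q_def algebra_simps)
  have "degree q = 2" "lead_coeff q = 1" by (simp_all add: q_def)
  moreover from this have "degree (q ^ Suc n) = 2 * Suc n"
    using degree_power_eq[of q "Suc n"] by (metis mult.commute leading_coeff_0_iff zero_neq_one)
  ultimately have q: "degree (q ^ Suc n) = 2 * Suc n" "coeff (q ^ Suc n) (2 * Suc n) = 1"
    using lead_coeff_power[of q "Suc n"] by (metis, metis power_one)
  then have "degree g \<le> 2 * Suc n" "coeff g (2 * Suc n) = 0"
    using Suc.prems(2) unfolding g_def k_def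
    by (auto intro!: degree_diff_le degree_smult_le[THEN order.trans] simp del: power_Suc)
  then have degg: "degree g < 2 * Suc n"
    by (metis leading_coeff_0_iff degree_0 le_neq_implies_less zero_less_Suc mult_pos_pos zero_less_numeral)
  have symg: "c ^ Suc n * poly g z = z ^ (2 * Suc n) * poly g (c / z)" if z: "z \<noteq> 0" for z
  proof -
    have "c * poly q z = z ^ 2 * poly q (c / z)"
      using z c by (simp add: q_def field_simps power2_eq_square)
    then have "(c * poly q z) ^ Suc n = (z ^ 2 * poly q (c / z)) ^ Suc n" by simp
    then have "c ^ Suc n * poly q z ^ Suc n = z ^ (2 * Suc n) * poly q (c / z) ^ Suc n"
      by (simp only: power_mult_distrib power_mult)
    then have "k * (c ^ Suc n * poly q z ^ Suc n) = k * (z ^ (2 * Suc n) * poly q (c / z) ^ Suc n)"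
      by simp
    then show ?thesis using Suc.prems(3)[OF z]
      unfolding g_def by (simp only: poly_diff poly_smult poly_power right_diff_distrib mult_ac)
  qed
  have "coeff g 0 = 0"
    using self_reciprocal_coeff_0[OF c degg symg] .
  then obtain h where h: "g = pCons 0 h" by (cases g) auto
  have "degree h \<le> 2 * n" using degg by (cases "h = 0") (auto simp: h)
  moreover have "c ^ n * poly h z = z ^ (2 * n) * poly h (c / z)" if z: "z \<noteq> 0" for z
    using symg[OF z] z c by (simp add: h power2_eq_square field_simps)
  ultimately obtain H where H: "degree H \<le> n"
    "\<And>z. z \<noteq> 0 \<Longrightarrow> poly h z = z ^ n * poly H (z + c / z)"
    using Suc.IH by blast
  have "degree (H + monom k (Suc n)) \<le> Suc n"
    using H(1) by (intro degree_add_le degree_monom_le) auto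
  moreover have "poly f z = z ^ Suc n * poly (H + monom k (Suc n)) (z + c / z)" if z: "z \<noteq> 0" for z
  proof -
    have "poly f z = poly g z + k * poly q z ^ Suc n" by (simp add: g_def)
    also have "\<dots> = z * (z ^ n * poly H (z + c / z)) + k * (z * (z + c / z)) ^ Suc n"
      using H(2)[OF z] qz[OF z] by (simp add: h)
    finally show ?thesis
      by (simp only: poly_add poly_monom power_mult_distrib distrib_left[of "z ^ Suc n"])
        (simp add: mult_ac)
  qed
  ultimately show ?case using Suc.prems(1) by blast
qed

section \<open>Transfer back to the variable \<open>y\<close>\<close>

theorem theorem1p1:
  fixes n :: nat and c y :: "'a::field_char_0" and a b :: "nat \<Rightarrow> 'a" and f :: "'a poly"
  assumes "n \<ge> 1" and "c \<noteq> 0"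
    and "\<And>i. i \<in> {1..n} \<Longrightarrow> a i \<noteq> 0"
    and "\<And>i. i \<in> {1..n} \<Longrightarrow> b i \<noteq> 0"
    and "\<And>k i. k \<in> {1..n} \<Longrightarrow> i \<in> {1..n} \<Longrightarrow> k + i \<le> n + 2 \<Longrightarrow>
           (b k - a i) * (b k - c / a i) \<noteq> 0"
    and "\<And>k i. k \<in> {1..n} \<Longrightarrow> i \<in> {1..n} \<Longrightarrow> k \<noteq> i \<Longrightarrow>
           (b k - b i) * (1 - c / (b k * b i)) \<noteq> 0"
    and "degree f = 2 * n"
    and "\<And>z. z \<noteq> 0 \<Longrightarrow>
           z powi (- int n) * poly f z = (c / z) powi (- int n) * poly f (c / z)"
  shows "poly f y =
      poly f (b 1) / (\<Prod>i = 1..n. (b 1 - a i) * (b 1 - c / a i))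
        * (\<Prod>i = 1..n. (y - a i) * (y - c / a i))
    + poly f (a 1) / (\<Prod>i = 1..n. (a 1 - b i) * (a 1 - c / b i))
        * (\<Prod>i = 1..n. (y - b i) * (y - c / b i))
    + (\<Sum>j = 1..n - 1. interp_coeff c n f a b j
        * (\<Prod>i = 1..j. (y - b i) * (y - c / b i))
        * (\<Prod>i = 1..n - j. (y - a i) * (y - c / a i)))"
proof -
  define \<alpha> where "\<alpha> i = a i + c / a i" for i
  define \<beta> where "\<beta> i = b i + c / b i" for i
  have sym: "c ^ n * poly f z = z ^ (2 * n) * poly f (c / z)" if "z \<noteq> 0" for z
  proof -
    have "poly f z * c ^ n = z ^ n * (z ^ n * poly f (c / z))"
      using assms(8)[OF that] that \<open>c \<noteq> 0\<close> by (simp add: power_int_minus field_simps)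
    then show ?thesis unfolding mult_2 power_add by (simp only: mult_ac)
  qed
  obtain F where degF: "degree F \<le> n"
    and F: "\<And>z. z \<noteq> 0 \<Longrightarrow> poly f z = z ^ n * poly F (z + c / z)"
    using self_reciprocal_poly_obtain[OF \<open>c \<noteq> 0\<close> _ sym] assms(7) by auto
  have prod_a: "(\<Prod>i = 1..m. (z - a i) * (z - c / a i)) = z ^ m * (\<Prod>i = 1..m. (z + c / z) - \<alpha> i)"
    if "m \<le> n" "z \<noteq> 0" for m z
  proof -
    have "(\<Prod>i = 1..m. (z - a i) * (z - c / a i)) = (\<Prod>i = 1..m. z * ((z + c / z) - \<alpha> i))"
      using that assms(3) unfolding \<alpha>_def by (intro prod.cong c_quadratic) auto
    then show ?thesis by (simp add: prod.distrib)
  qed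
  have prod_b: "(\<Prod>i = 1..m. (z - b i) * (z - c / b i)) = z ^ m * (\<Prod>i = 1..m. (z + c / z) - \<beta> i)"
    if "m \<le> n" "z \<noteq> 0" for m z
  proof -
    have "(\<Prod>i = 1..m. (z - b i) * (z - c / b i)) = (\<Prod>i = 1..m. z * ((z + c / z) - \<beta> i))"
      using that assms(4) unfolding \<beta>_def by (intro prod.cong c_quadratic) auto
    then show ?thesis by (simp add: prod.distrib)
  qed
  have inj: "inj_on \<beta> {1..n}"
  proof (rule inj_onI, rule ccontr)
    fix k i assume ki: "k \<in> {1..n}" "i \<in> {1..n}" "\<beta> k = \<beta> i" "k \<noteq> i"
    then show False
      using assms(6)[of k i] c_difference[OF assms(4) assms(4), of k i c] by (simp add: \<beta>_def)
  qed
  have \<beta>\<alpha>: "\<beta> k \<noteq> \<alpha> i" if "k \<in> {1..n}" "i \<in> {1..n}" "k + i \<le> n + 2" for k i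
    using assms(5)[OF that] c_quadratic[of "b k" "a i" c] assms(3,4) that by (auto simp: \<alpha>_def \<beta>_def)
  have coeff: "interp_coeff c n f a b j =
      divdiff \<beta> (\<lambda>s. poly F s / (\<Prod>i = 1..n - j + 1. s - \<alpha> i)) j (\<beta> (j + 1))
        * (\<beta> (j + 1) - \<alpha> (n - j + 1))" if j: "j \<in> {1..n - 1}" for j
  proof -
    let ?g = "\<lambda>z. poly f z * z powi (1 - int j) / (\<Prod>i = 1..n - j + 1. (z - a i) * (z - c / a i))"
    \<comment> \<open>The exponent \<open>1 - int j\<close> is what makes this a function of
      \<open>z + c / z\<close> alone: it reduces the factor \<open>z ^ n\<close> of \<open>f\<close>
      to \<open>z ^ (n - j + 1)\<close>, the power contributed by the quadratic factors
      below.\<close>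
    have g: "?g z = poly F (z + c / z) / (\<Prod>i = 1..n - j + 1. (z + c / z) - \<alpha> i)"
      if z: "z \<noteq> 0" for z
    proof -
      have "z ^ n * z powi (1 - int j) = z ^ (n - j + 1)"
      proof -
        have "int n + (1 - int j) = int (n - j + 1)" using j by auto
        then show ?thesis
          using z power_int_add[of z "int n" "1 - int j"] by (simp only: power_int_of_nat simp_thms)
      qed
      then have "poly f z * z powi (1 - int j) = z ^ (n - j + 1) * poly F (z + c / z)"
        unfolding F[OF z] by (metis mult.assoc mult.commute)
      moreover have "n - j + 1 \<le> n" using j by auto
      ultimately have "?g z = (z ^ (n - j + 1) * poly F (z + c / z)) /
          (z ^ (n - j + 1) * (\<Prod>i = 1..n - j + 1. (z + c / z) - \<alpha> i))"
        by (simp only: prod_a[OF _ z])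
      then show ?thesis using z by simp
    qed
    have "cdivdiffs c j (\<lambda>x. ?g (x 1)) b
      = divdiff \<beta> (\<lambda>s. poly F s / (\<Prod>i = 1..n - j + 1. s - \<alpha> i)) j (\<beta> (Suc j))"
      unfolding \<beta>_def using j assms(4) by (intro cdivdiffs_eq_divdiff g) auto
    moreover have "(b (j + 1) - a (n - j + 1)) * (1 - c / (a (n - j + 1) * b (j + 1)))
        = \<beta> (j + 1) - \<alpha> (n - j + 1)"
      using j assms(3)[of "n - j + 1"] assms(4)[of "j + 1"] c_difference[of "b (j + 1)" "a (n - j + 1)" c]
      by (auto simp: \<alpha>_def \<beta>_def mult.commute)
    ultimately show ?thesis by (simp add: interp_coeff_def)
  qed
  \<comment> \<open>The right-hand side becomes a polynomial \<open>R\<close>, so that equality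
    outside the finite set \<open>S\<close> gives the formula at every \<open>y\<close>, including 0
    and the nodes.\<close>
  define q where "q u = [:-u, 1:] * [:-(c / u), 1:]" for u
  have q: "poly (q u) z = (z - u) * (z - c / u)" for u z
    unfolding q_def poly_mult by simp
  define R where "R =
      smult (poly f (b 1) / (\<Prod>i = 1..n. (b 1 - a i) * (b 1 - c / a i))) (\<Prod>i = 1..n. q (a i))
    + smult (poly f (a 1) / (\<Prod>i = 1..n. (a 1 - b i) * (a 1 - c / b i))) (\<Prod>i = 1..n. q (b i))
    + (\<Sum>j = 1..n - 1. smult (interp_coeff c n f a b j)
        ((\<Prod>i = 1..j. q (b i)) * (\<Prod>i = 1..n - j. q (a i))))"
  \<comment> \<open>Outside \<open>S\<close> the quadratics \<open>(z - a i) * (z - c / a i)\<close>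
    and their analogues for \<open>b\<close> are nonzero, hence \<open>z + c / z\<close> avoids all
    \<open>\<alpha> i\<close> and \<open>\<beta> i\<close>.\<close>
  define S where "S = insert 0 (\<Union>i\<in>{1..n}. {a i, c / a i, b i, c / b i})"
  have "poly f z = poly R z" if z: "z \<notin> S" for z
  proof -
    have z0: "z \<noteq> 0" using z by (simp add: S_def)
    define t where "t = z + c / z"
    have t\<alpha>: "t \<notin> \<alpha> ` {1..n}"
      using z z0 c_quadratic[OF z0 assms(3), of _ c] by (force simp: S_def t_def \<alpha>_def)
    have t\<beta>: "t \<notin> \<beta> ` {1..n}"
      using z z0 c_quadratic[OF z0 assms(4), of _ c] by (force simp: S_def t_def \<beta>_def)
    have "poly f z = z ^ n * poly F t" using F[OF z0] by (simp add: t_def)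
    also have "\<dots> =
        poly F (\<beta> 1) / (\<Prod>i = 1..n. \<beta> 1 - \<alpha> i) * (z ^ n * (\<Prod>i = 1..n. t - \<alpha> i))
      + poly F (\<alpha> 1) / (\<Prod>i = 1..n. \<alpha> 1 - \<beta> i) * (z ^ n * (\<Prod>i = 1..n. t - \<beta> i))
      + (\<Sum>j = 1..n - 1. z ^ n * (
          divdiff \<beta> (\<lambda>s. poly F s / (\<Prod>i = 1..n - j + 1. s - \<alpha> i)) j (\<beta> (j + 1))
          * (\<beta> (j + 1) - \<alpha> (n - j + 1))
          * (\<Prod>i = 1..j. t - \<beta> i) * (\<Prod>i = 1..n - j. t - \<alpha> i)))"
      by (subst two_sided_Newton_interpolation[OF \<open>n \<ge> 1\<close> degF inj t\<beta> t\<alpha> \<beta>\<alpha>])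
        (simp_all add: distrib_left sum_distrib_left mult_ac)
    also have "(\<Sum>j = 1..n - 1. z ^ n * (
          divdiff \<beta> (\<lambda>s. poly F s / (\<Prod>i = 1..n - j + 1. s - \<alpha> i)) j (\<beta> (j + 1))
          * (\<beta> (j + 1) - \<alpha> (n - j + 1))
          * (\<Prod>i = 1..j. t - \<beta> i) * (\<Prod>i = 1..n - j. t - \<alpha> i)))
        = (\<Sum>j = 1..n - 1. interp_coeff c n f a b j *
          ((z ^ j * (\<Prod>i = 1..j. t - \<beta> i)) * (z ^ (n - j) * (\<Prod>i = 1..n - j. t - \<alpha> i))))"
    proof (rule sum.cong)
      fix j assume j: "j \<in> {1..n - 1}"
      \<comment> \<open>The powers of \<open>z\<close> are shared out with one for each quadratic
        factor: \<open>j\<close> to the \<open>b\<close> product and \<open>n - j\<close> to the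
        \<open>a\<close> product.\<close>
      then have "n = j + (n - j)" by auto
      then have zn: "z ^ n = z ^ j * z ^ (n - j)" by (metis power_add)
      show "z ^ n * (
          divdiff \<beta> (\<lambda>s. poly F s / (\<Prod>i = 1..n - j + 1. s - \<alpha> i)) j (\<beta> (j + 1))
          * (\<beta> (j + 1) - \<alpha> (n - j + 1))
          * (\<Prod>i = 1..j. t - \<beta> i) * (\<Prod>i = 1..n - j. t - \<alpha> i)) =
        interp_coeff c n f a b j *
          ((z ^ j * (\<Prod>i = 1..j. t - \<beta> i)) * (z ^ (n - j) * (\<Prod>i = 1..n - j. t - \<alpha> i)))"
        unfolding coeff[OF j] zn by (simp only: mult_ac)
    qed simp
    \<comment> \<open>Numerator and denominator over \<open>b 1\<close> both carry
      \<open>b 1 ^ n\<close>, which cancels.\<close>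
    also have "poly F (\<beta> 1) / (\<Prod>i = 1..n. \<beta> 1 - \<alpha> i) =
        poly f (b 1) / (\<Prod>i = 1..n. (b 1 - a i) * (b 1 - c / a i))"
      using assms(4)[of 1] \<open>n \<ge> 1\<close> by (subst prod_a) (auto simp: F \<beta>_def)
    also have "poly F (\<alpha> 1) / (\<Prod>i = 1..n. \<alpha> 1 - \<beta> i) =
        poly f (a 1) / (\<Prod>i = 1..n. (a 1 - b i) * (a 1 - c / b i))"
      using assms(3)[of 1] \<open>n \<ge> 1\<close> by (subst prod_b) (auto simp: F \<alpha>_def)
    also have "z ^ n * (\<Prod>i = 1..n. t - \<alpha> i) = (\<Prod>i = 1..n. poly (q (a i)) z)"
      unfolding q t_def using prod_a[OF order.refl z0] by simp
    also have "z ^ n * (\<Prod>i = 1..n. t - \<beta> i) = (\<Prod>i = 1..n. poly (q (b i)) z)"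
      unfolding q t_def using prod_b[OF order.refl z0] by simp
    also have "(\<Sum>j = 1..n - 1. interp_coeff c n f a b j *
          ((z ^ j * (\<Prod>i = 1..j. t - \<beta> i)) * (z ^ (n - j) * (\<Prod>i = 1..n - j. t - \<alpha> i))))
        = (\<Sum>j = 1..n - 1. interp_coeff c n f a b j *
          ((\<Prod>i = 1..j. poly (q (b i)) z) * (\<Prod>i = 1..n - j. poly (q (a i)) z)))"
      unfolding q t_def
      by (intro sum.cong arg_cong2[where f = "(*)"] refl prod_a[symmetric] prod_b[symmetric] z0) auto
    finally show ?thesis
      by (simp add: R_def poly_sum poly_prod)
  qed
  moreover have "finite S" by (simp add: S_def)
  ultimately have "f = R" by (intro poly_eq_if_cofinitely_eq)
  then have "poly f y = poly R y" by simp
  also have "\<dots> =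
      poly f (b 1) / (\<Prod>i = 1..n. (b 1 - a i) * (b 1 - c / a i))
        * (\<Prod>i = 1..n. (y - a i) * (y - c / a i))
    + poly f (a 1) / (\<Prod>i = 1..n. (a 1 - b i) * (a 1 - c / b i))
        * (\<Prod>i = 1..n. (y - b i) * (y - c / b i))
    + (\<Sum>j = 1..n - 1. interp_coeff c n f a b j
        * (\<Prod>i = 1..j. (y - b i) * (y - c / b i))
        * (\<Prod>i = 1..n - j. (y - a i) * (y - c / a i)))"
    unfolding R_def by (simp only: poly_add poly_smult poly_mult poly_sum poly_prod q mult.assoc)
  finally show ?thesis .
qed

end
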